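(* For every string $T$ and every LZRR parse $\mathsf{LZRR}(T)$ of $T$, the number of phrases satisfies $|\mathsf{LZRR}(T)|\le|\mathsf{LZ}(T^R)|$, where $T^R$ is the reverse of $T$ and $\mathsf{LZ}(\cdot)$ is the LZ77 parse.
   Context: Let $T=T[1]\cdots T[n]$ be a string over an ordered alphabet $\Sigma$ (elements of $\Sigma$ regarded as distinct from integers); $T^R=T[n]T[n-1]\cdots T[1]$. $T[a..b]$ is a substring, $T[a..]=T[a..n]$, and $\mathsf{lcp}(a,b)$ is the length of the longest common prefix of $T[a..]$ and $T[b..]$. LZ77 parse: for a string $S$ of length $n$, let $\mathsf{LPF}[1]=0$ and $\mathsf{LPF}[s]=\max\{\mathsf{lcp}(s,p):1\le p<s\}$ (lcp taken in $S$). $\mathsf{LZ}(S)=f_1,\dots,f_z$ is the partition of $S$ into consecutive phrases with $s_1=1$, $s_{x+1}=s_x+|f_x|$ and $|f_x|=\max\{1,\mathsf{LPF}[s_x]\}$; $|\mathsf{LZ}(S)|=z$. A bidirectional parse (BP) of $T$ is a sequence of phrases $f_1,\dots,f_b$ partitioning $T$, with $f_x=T[s_x..s_x+|f_x|-1]$, $s_1=1$, $s_{x+1}=s_x+|f_x|$, $s_{b+1}=n+1$; each phrase is a character phrase ($|f_x|=1$, storing $T[s_x]$) or a target phrase $\langle t_x,|f_x|\rangle$ with $t_x\ne s_x$, $t_x+|f_x|-1\le n$, $T[t_x..t_x+|f_x|-1]=T[s_x..s_x+|f_x|-1]$. Define $g^0(x)=T[x]$ if $x$ lies in a character phrase and $g^0(x)=t_p+(x-s_p)$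 if $x$ lies in target phrase $f_p$; $g^k(x)=g^{k-1}(x)$ if $g^{k-1}(x)\in\Sigma$, else $g^k(x)=g^0(g^{k-1}(x))$. The BP is valid if $g^n(x)\in\Sigma$ for all $x$. A partial bidirectional parse (PBP) $P$ is such a sequence of phrases partitioning only a prefix $T[1..m]$ (references anywhere in $\{1,\dots,n\}$ other than the phrase's own start); $i=m+1$ is the position following $P$; $B_P$ is $P$ followed by the character phrases $T[m+1],\dots,T[n]$; $P$ is valid if $B_P$ is valid; $P\cdot f$ appends phrase $f$. For a valid PBP $P$ with following position $i\le n$ and $j\in\{1,\dots,n\}$: $\mathsf{LF}(P,j)=\max(\{0\}\cup\{\ell\in\{1,\dots,\mathsf{lcp}(i,j)\}:P\cdot\langle j,\ell\rangle\text{ is a valid PBP}\})$. With $M=\max_j\mathsf{LF}(P,j)$, $\mathsf{LP}(P)$ is $\langle j^*,M\rangle$ for some $j^*$ with $\mathsf{LF}(P,j^* )=M$ if $M>0$, and the character phrase $T[i]$ otherwise. An LZRR parse $\mathsf{LZRR}(T)=f_1,\dots,f_b$ is obtained by $P_0=$ empty, $f_{p+1}=\mathsf{LP}(P_p)$, $P_{p+1}=P_p\cdot f_{p+1}$, until $P_b$ covers $T$; $|\mathsf{LZRR}(T)|=b$. *)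

theory Defs
  imports Main "HOL-Library.Sublist"
begin

text \<open>
  Positions in a string are 1-based, while the phrases of a parse form a list and are
  indexed from 0: \<open>P ! x\<close> is the (\<open>x + 1\<close>)-st phrase.
\<close>

definition char_at :: "'a list \<Rightarrow> nat \<Rightarrow> 'a" where
  "char_at T i = T ! (i - 1)"

definition substr :: "'a list \<Rightarrow> nat \<Rightarrow> nat \<Rightarrow> 'a list" where
  "substr T a b = take (b + 1 - a) (drop (a - 1) T)"

definition suffix_from :: "'a list \<Rightarrow> nat \<Rightarrow> 'a list" where
  "suffix_from T a = substr T a (length T)"

definition lcp :: "'a list \<Rightarrow> nat \<Rightarrow> nat \<Rightarrow> nat" where
  "lcp T a b = length (longest_common_prefix (suffix_from T a) (suffix_from T b))"

definition LPF :: "'a list \<Rightarrow> nat \<Rightarrow> nat" where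
  "LPF S s = (if s = 1 then 0 else Max {lcp S s p | p. 1 \<le> p \<and> p < s})"

definition lz_len :: "'a list \<Rightarrow> nat \<Rightarrow> nat" where
  "lz_len S s = max 1 (LPF S s)"

function LZ_from :: "'a list \<Rightarrow> nat \<Rightarrow> 'a list list" where
  "LZ_from S s =
     (if s \<le> length S
      then substr S s (s + lz_len S s - 1) # LZ_from S (s + lz_len S s)
      else [])"
  by pat_completeness auto
termination
  by (relation "measure (\<lambda>(S, s). length S + 1 - s)") (auto simp: lz_len_def)

declare LZ_from.simps [simp del]

definition LZ :: "'a list \<Rightarrow> 'a list list" where
  "LZ S = LZ_from S 1"

datatype 'a phrase = Character 'a | Target nat nat

fun phrase_len :: "'a phrase \<Rightarrow> nat" where
  "phrase_len (Character c) = 1"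
| "phrase_len (Target t l) = l"

definition parse_len :: "'a phrase list \<Rightarrow> nat" where
  "parse_len P = sum_list (map phrase_len P)"

definition phrase_start :: "'a phrase list \<Rightarrow> nat \<Rightarrow> nat" where
  "phrase_start P x = 1 + parse_len (take x P)"

definition next_pos :: "'a phrase list \<Rightarrow> nat" where
  "next_pos P = parse_len P + 1"

fun phrase_ok :: "'a list \<Rightarrow> nat \<Rightarrow> 'a phrase \<Rightarrow> bool" where
  "phrase_ok T s (Character c) \<longleftrightarrow> c = char_at T s"
| "phrase_ok T s (Target t l) \<longleftrightarrow>
     1 \<le> l \<and> 1 \<le> t \<and> t \<noteq> s \<and> t + l - 1 \<le> length T \<and>
     substr T t (t + l - 1) = substr T s (s + l - 1)"

definition is_PBP :: "'a list \<Rightarrow> 'a phrase list \<Rightarrow> bool" where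
  "is_PBP T P \<longleftrightarrow>
     parse_len P \<le> length T \<and> (\<forall>x<length P. phrase_ok T (phrase_start P x) (P ! x))"

definition is_BP :: "'a list \<Rightarrow> 'a phrase list \<Rightarrow> bool" where
  "is_BP T B \<longleftrightarrow> is_PBP T B \<and> parse_len B = length T"

definition phrase_at :: "'a phrase list \<Rightarrow> nat \<Rightarrow> nat" where
  "phrase_at B x = (THE p. p < length B \<and> phrase_start B p \<le> x \<and>
                           x < phrase_start B p + phrase_len (B ! p))"

text \<open>
  The values of the reference maps lie in the disjoint union of the alphabet (\<open>Inl\<close>)
  and the positions (\<open>Inr\<close>).
\<close>

definition g0 :: "'a list \<Rightarrow> 'a phrase list \<Rightarrow> nat \<Rightarrow> 'a + nat" where
  "g0 T B x =
     (let p = phrase_at B x in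
      case B ! p of
        Character c \<Rightarrow> Inl (char_at T x)
      | Target t l \<Rightarrow> Inr (t + (x - phrase_start B p)))"

fun g :: "'a list \<Rightarrow> 'a phrase list \<Rightarrow> nat \<Rightarrow> nat \<Rightarrow> 'a + nat" where
  "g T B 0 x = g0 T B x"
| "g T B (Suc k) x = (case g T B k x of Inl c \<Rightarrow> Inl c | Inr y \<Rightarrow> g0 T B y)"

definition valid_BP :: "'a list \<Rightarrow> 'a phrase list \<Rightarrow> bool" where
  "valid_BP T B \<longleftrightarrow> is_BP T B \<and> (\<forall>x\<in>{1..length T}. isl (g T B (length T) x))"

definition completion :: "'a list \<Rightarrow> 'a phrase list \<Rightarrow> 'a phrase list" where
  "completion T P = P @ map Character (suffix_from T (next_pos P))"

definition valid_PBP :: "'a list \<Rightarrow> 'a phrase list \<Rightarrow> bool" where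
  "valid_PBP T P \<longleftrightarrow> is_PBP T P \<and> valid_BP T (completion T P)"

definition LF :: "'a list \<Rightarrow> 'a phrase list \<Rightarrow> nat \<Rightarrow> nat" where
  "LF T P j =
     Max ({0} \<union> {l \<in> {1..lcp T (next_pos P) j}. valid_PBP T (P @ [Target j l])})"

definition max_LF :: "'a list \<Rightarrow> 'a phrase list \<Rightarrow> nat" where
  "max_LF T P = Max (LF T P ` {1..length T})"

text \<open>
  The longest next phrase is determined only up to the choice of a source position that
  attains the maximum, so it is given as a relation, as are the parses built from it.
\<close>

definition is_LP :: "'a list \<Rightarrow> 'a phrase list \<Rightarrow> 'a phrase \<Rightarrow> bool" where
  "is_LP T P f \<longleftrightarrow>
     (if max_LF T P > 0
      then \<exists>j\<in>{1..length T}. LF T P j = max_LF T P \<and> f = Target j (max_LF T P)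
      else f = Character (char_at T (next_pos P)))"

inductive LZRR_partial :: "'a list \<Rightarrow> 'a phrase list \<Rightarrow> bool" for T where
  empty: "LZRR_partial T []"
| step: "LZRR_partial T P \<Longrightarrow> next_pos P \<le> length T \<Longrightarrow> is_LP T P f \<Longrightarrow> LZRR_partial T (P @ [f])"

definition is_LZRR :: "'a list \<Rightarrow> 'a phrase list \<Rightarrow> bool" where
  "is_LZRR T F \<longleftrightarrow> LZRR_partial T F \<and> parse_len F = length T"

end

theory Submission
  imports Defs
begin

text \<open>
  Read from right to left, every phrase of the LZ77 parse of the reversed string is a
  single character or an interval of \<open>T\<close> with a further occurrence to its right, and the
  same then holds for each suffix of the interval. Appending to a valid partial parse a
  phrase that refers to the right never creates a cycle: the new references increase until
  they leave the phrase, and everything behind it is still a character. Hence an LZRR phrase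
  that starts inside such an interval reaches at least its end, so that each interval
  contains the start of at most one LZRR phrase.
\<close>

section \<open>Common prefixes\<close>

lemma suffix_from_eq_drop: "1 \<le> a \<Longrightarrow> suffix_from T a = drop (a - 1) T"
  by (simp add: suffix_from_def substr_def)

lemma substr_eq_take_drop: "1 \<le> l \<Longrightarrow> substr T a (a + l - 1) = take l (drop (a - 1) T)"
  by (simp add: substr_def)

lemma le_length_longest_common_prefix_iff:
  "m \<le> length (longest_common_prefix xs ys) \<longleftrightarrow>
     m \<le> length xs \<and> m \<le> length ys \<and> take m xs = take m ys"
proof (induction xs ys arbitrary: m rule: longest_common_prefix.induct)
  case (1 x xs y ys)
  then show ?case by (cases m) auto
qed auto

lemma le_lcp_iff:
  assumes "1 \<le> a" "1 \<le> b" "1 \<le> m"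
  shows "m \<le> lcp T a b \<longleftrightarrow>
    a + m \<le> length T + 1 \<and> b + m \<le> length T + 1 \<and>
    (\<forall>k<m. T ! (a - 1 + k) = T ! (b - 1 + k))"
proof -
  have "m \<le> lcp T a b \<longleftrightarrow> m \<le> length (drop (a - 1) T) \<and> m \<le> length (drop (b - 1) T) \<and>
      take m (drop (a - 1) T) = take m (drop (b - 1) T)"
    using assms by (simp only: lcp_def suffix_from_eq_drop le_length_longest_common_prefix_iff)
  also have "\<dots> \<longleftrightarrow> a + m \<le> length T + 1 \<and> b + m \<le> length T + 1 \<and>
      take m (drop (a - 1) T) = take m (drop (b - 1) T)"
    using assms by auto
  also have "\<dots> \<longleftrightarrow> a + m \<le> length T + 1 \<and> b + m \<le> length T + 1 \<and>
    (\<forall>k<m. T ! (a - 1 + k) = T ! (b - 1 + k))"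
    using assms by (intro conj_cong refl) (simp add: list_eq_iff_nth_eq)
  finally show ?thesis .
qed

text \<open>Reversal sends position \<open>x\<close> of \<open>rev T\<close> to
  \<open>length T + 1 - x\<close> of \<open>T\<close>. The earlier occurrence at \<open>p\<close>
  thus becomes one shifted by \<open>s - p\<close> to the right, and
  \<open>length T + 2 - s - i\<close> is the distance from \<open>i\<close> through the mirrored end
  \<open>length T + 1 - s\<close>.\<close>

lemma lcp_rev_imp_right_occurrence:
  assumes p: "1 \<le> p" "p < s"
    and i: "i + s \<le> length T + 1" "length T + 1 < i + s + lcp (rev T) s p"
  shows "length T + 2 - s - i \<le> lcp T i (i + (s - p))"
proof -
  define n l m where "n = length T" and "l = lcp (rev T) s p" and "m = n + 2 - s - i"
  have l: "1 \<le> l" using i by (simp add: l_def)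
  then have rev_eq: "s + l \<le> n + 1" "\<forall>k<l. rev T ! (s - 1 + k) = rev T ! (p - 1 + k)"
    using le_lcp_iff[of s p l "rev T"] p by (simp_all add: l_def n_def)
  have m: "1 \<le> m" "m \<le> l" "i + m + s = n + 2" and i1: "1 \<le> i"
    using i rev_eq l p unfolding n_def[symmetric] l_def[symmetric] m_def by linarith+
  have "T ! (i - 1 + k) = T ! (i + (s - p) - 1 + k)" if "k < m" for k
  proof -
    \<comment> \<open>Offset \<open>k\<close> from \<open>i\<close> in \<open>T\<close> is offset
      \<open>m - 1 - k\<close> from \<open>s\<close> in \<open>rev T\<close>, because both stretches
      end at mirror images of each other.\<close>
    define j where "j = m - 1 - k"
    have "j < l" using m that by (simp add: j_def)
    then have "rev T ! (s - 1 + j) = rev T ! (p - 1 + j)" using rev_eq by blast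
    moreover have "s - 1 + j < n" "p - 1 + j < n" using \<open>j < l\<close> rev_eq p by linarith+
    ultimately have "T ! (n - Suc (s - 1 + j)) = T ! (n - Suc (p - 1 + j))"
      by (simp add: rev_nth n_def)
    moreover have "n - Suc (s - 1 + j) = i - 1 + k" "n - Suc (p - 1 + j) = i + (s - p) - 1 + k"
      using m that p i1 unfolding j_def by linarith+
    ultimately show ?thesis by simp
  qed
  then have "m \<le> lcp T i (i + (s - p))"
    using le_lcp_iff[of i "i + (s - p)" m T] i1 m p by (simp add: n_def)
  then show ?thesis by (simp add: m_def n_def)
qed

text \<open>Length one is split off without a source, since any nonempty LZRR phrase covers a single
  position. Any other length exceeds 1 and is a maximum attained over a nonempty finite set;
  \<open>s = 1\<close> is excluded there because \<open>LPF S 1 = 0\<close>.\<close>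

lemma lz_len_cases:
  assumes "1 \<le> s"
  obtains "lz_len S s = 1" | p where "1 \<le> p" "p < s" "lz_len S s = lcp S s p"
proof (cases "lz_len S s = 1")
  case False
  then have l: "lz_len S s = LPF S s" by (auto simp: lz_len_def max_def split: if_splits)
  then have "s \<noteq> 1" by (auto simp: lz_len_def LPF_def)
  then have "LPF S s = Max {lcp S s p | p. 1 \<le> p \<and> p < s}" by (simp add: LPF_def)
  moreover have "{lcp S s p | p. 1 \<le> p \<and> p < s} \<noteq> {}"
    using assms \<open>s \<noteq> 1\<close> by (auto intro!: exI[of _ 1])
  moreover have "finite {lcp S s p | p. 1 \<le> p \<and> p < s}" by simp
  ultimately have "LPF S s \<in> {lcp S s p | p. 1 \<le> p \<and> p < s}" by (simp only: Max_in not_False_eq_True)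
  then show ?thesis using that(2) l by auto
qed (use that in blast)

section \<open>Phrases and references\<close>

lemma parse_len_simps [simp]:
  "parse_len [] = 0" "parse_len (f # P) = phrase_len f + parse_len P"
  "parse_len (P @ Q) = parse_len P + parse_len Q" "parse_len (map Character cs) = length cs"
  by (simp_all add: parse_len_def comp_def sum_list_triv)

lemma phrase_start_append [simp]:
  "x \<le> length P \<Longrightarrow> phrase_start (P @ Q) x = phrase_start P x"
  "phrase_start (P @ Q) (length P + k) = parse_len P + phrase_start Q k"
  by (simp_all add: phrase_start_def)

lemma phrase_start_Suc:
  "x < length B \<Longrightarrow> phrase_start B (Suc x) = phrase_start B x + phrase_len (B ! x)"
  by (simp add: phrase_start_def take_Suc_conv_app_nth)

lemma phrase_start_mono:
  assumes "x \<le> y"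
  shows "phrase_start B x \<le> phrase_start B y"
proof -
  have "take y B = take x B @ take (y - x) (drop x B)"
    using assms take_add[of x "y - x" B] by simp
  then show ?thesis by (simp add: phrase_start_def)
qed

lemma phrase_at_eqI:
  assumes p: "p < length B" "phrase_start B p \<le> x" "x < phrase_start B p + phrase_len (B ! p)"
  shows "phrase_at B x = p"
  unfolding phrase_at_def
proof (rule the_equality)
  fix q assume q: "q < length B \<and> phrase_start B q \<le> x \<and> x < phrase_start B q + phrase_len (B ! q)"
  show "q = p"
    \<comment> \<open>Of two distinct phrases, the later one starts no earlier than the successor of
      the other, hence beyond the end of the other.\<close>
    using p q phrase_start_mono[of "Suc p" q B] phrase_start_mono[of "Suc q" p B]
    by (cases q p rule: linorder_cases) (auto simp: phrase_start_Suc)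
qed (use p in simp)

lemma ex_phrase_at:
  assumes "1 \<le> x" "x \<le> parse_len B"
  shows "\<exists>p<length B. phrase_start B p \<le> x \<and> x < phrase_start B p + phrase_len (B ! p)"
  using assms
proof (induction B rule: rev_induct)
  case (snoc f B)
  show ?case
  proof (cases "x \<le> parse_len B")
    case True
    then obtain p where "p < length B" "phrase_start B p \<le> x" "x < phrase_start B p + phrase_len (B ! p)"
      using snoc by blast
    then show ?thesis by (intro exI[of _ p]) (simp add: nth_append)
  next
    case False
    then show ?thesis using snoc.prems
      by (intro exI[of _ "length B"]) (simp add: phrase_start_def)
  qed
qed simp

lemma g0_append:
  assumes "1 \<le> x" "x \<le> parse_len P"
  shows "g0 T (P @ Q) x = g0 T P x"
proof -
  obtain p where p: "p < length P" "phrase_start P p \<le> x" "x < phrase_start P p + phrase_len (P ! p)"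
    using ex_phrase_at assms by blast
  then have "phrase_at P x = p" "phrase_at (P @ Q) x = p"
    by (auto intro!: phrase_at_eqI simp: nth_append)
  with p show ?thesis by (simp add: g0_def nth_append split: phrase.split)
qed

lemma g0_snoc_Target:
  assumes "parse_len P < x" "x \<le> parse_len P + l"
  shows "g0 T (P @ [Target t l]) x = Inr (t + (x - next_pos P))"
proof -
  have "phrase_at (P @ [Target t l]) x = length P"
    using assms by (intro phrase_at_eqI) (simp_all add: phrase_start_def)
  then show ?thesis by (simp add: g0_def phrase_start_def next_pos_def)
qed

lemma completion_eq: "completion T P = P @ map Character (drop (parse_len P) T)"
  by (simp add: completion_def next_pos_def suffix_from_eq_drop)

lemma g0_completion_right:
  assumes "parse_len P < x" "x \<le> length T"
  shows "g0 T (completion T P) x = Inl (char_at T x)"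
proof -
  \<comment> \<open>The padding phrases have length one, so the 0-based offset of \<open>x\<close>
    behind the parse is also the index of its phrase in the padding.\<close>
  define k where "k = x - Suc (parse_len P)"
  have k: "k < length (drop (parse_len P) T)" and x: "x = Suc (parse_len P + k)"
    using assms by (simp_all add: k_def)
  have "phrase_start (map Character (drop (parse_len P) T)) k = Suc k"
    using k by (simp add: phrase_start_def take_map)
  then have "phrase_at (completion T P) x = length P + k"
    using k x unfolding completion_eq by (intro phrase_at_eqI) simp_all
  then show ?thesis using k by (simp add: g0_def completion_eq nth_append)
qed

lemma is_PBP_append_iff:
  "is_PBP T (P @ Q) \<longleftrightarrow> parse_len P + parse_len Q \<le> length T \<and> is_PBP T P \<and>
     (\<forall>k<length Q. phrase_ok T (parse_len P + phrase_start Q k) (Q ! k))"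
proof -
  have "(\<forall>x<length (P @ Q). phrase_ok T (phrase_start (P @ Q) x) ((P @ Q) ! x)) \<longleftrightarrow>
     (\<forall>x<length P. phrase_ok T (phrase_start P x) (P ! x)) \<and>
     (\<forall>k<length Q. phrase_ok T (parse_len P + phrase_start Q k) (Q ! k))"
    (is "?L \<longleftrightarrow> ?A \<and> ?B")
  proof
    assume L: ?L
    have "phrase_ok T (phrase_start P x) (P ! x)" if "x < length P" for x
      using L[rule_format, of x] that by (simp add: nth_append)
    moreover have "phrase_ok T (parse_len P + phrase_start Q k) (Q ! k)" if "k < length Q" for k
      using L[rule_format, of "length P + k"] that by simp
    ultimately show "?A \<and> ?B" by blast
  next
    assume AB: "?A \<and> ?B"
    show ?L
    proof (intro allI impI)
      fix x assume x: "x < length (P @ Q)"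
      show "phrase_ok T (phrase_start (P @ Q) x) ((P @ Q) ! x)"
      proof (cases "x < length P")
        case False
        then obtain k where "x = length P + k" by (metis le_Suc_ex not_less)
        with AB x show ?thesis by simp
      qed (use AB in \<open>simp add: nth_append\<close>)
    qed
  qed
  then show ?thesis by (auto simp: is_PBP_def)
qed

lemma is_BP_completion: "is_PBP T P \<Longrightarrow> is_BP T (completion T P)"
  by (auto simp: is_BP_def completion_eq is_PBP_append_iff phrase_start_def take_map char_at_def)
    (simp_all add: is_PBP_def)

lemma g0_Inr_in_range:
  assumes "is_BP T B" "x \<in> {1..length T}" "g0 T B x = Inr y"
  shows "y \<in> {1..length T}"
proof -
  obtain p where p: "p < length B" "phrase_start B p \<le> x" "x < phrase_start B p + phrase_len (B ! p)"
    using ex_phrase_at[of x B] assms by (auto simp: is_BP_def)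
  then have "phrase_at B x = p" by (rule phrase_at_eqI)
  moreover have "phrase_ok T (phrase_start B p) (B ! p)"
    using assms(1) p by (simp add: is_BP_def is_PBP_def)
  ultimately show ?thesis using assms(3) p by (auto simp: g0_def split: phrase.splits)
qed

section \<open>Termination of references\<close>

text \<open>The definition of \<open>g\<close> adds a step at the end of a chain; inductions along a
  chain need the first reference peeled off instead.\<close>

lemma g_Suc_front: "g T B (Suc k) x = (case g0 T B x of Inl c \<Rightarrow> Inl c | Inr y \<Rightarrow> g T B k y)"
  by (induction k) (auto split: sum.splits)

lemma isl_g_mono: "k \<le> m \<Longrightarrow> isl (g T B k x) \<Longrightarrow> isl (g T B m x)"
  by (induction m rule: dec_induct) (auto simp: isl_def)

text \<open>
  Along a terminating chain of references the remaining depth takes every value down to 0,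
  so its starting value is smaller than the number of positions.
\<close>

lemma isl_g_length:
  assumes B: "is_BP T B" and x: "x \<in> {1..length T}" and halt: "isl (g T B k x)"
  shows "isl (g T B (length T) x)"
proof -
  define D where "D x = (LEAST k. isl (g T B k x))" for x
  have "{..D x} \<subseteq> D ` {1..length T}"
    using x halt
  proof (induction k arbitrary: x)
    case 0
    then have "D x = 0" by (simp add: D_def)
    with 0 show ?case by force
  next
    case (Suc k)
    show ?case
    proof (cases "g0 T B x")
      case (Inl c)
      then have "D x = 0" by (simp add: D_def)
      with Suc.prems show ?thesis by force
    next
      case (Inr y)
      then have y: "y \<in> {1..length T}" using g0_Inr_in_range B Suc.prems(1) by blast
      \<comment> \<open>A reference at \<open>x\<close> rules out halting at step 0, as
        \<open>Least_Suc\<close> requires.\<close>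
      have "D x = Suc (LEAST k. isl (g T B (Suc k) x))"
        unfolding D_def using Suc.prems(2) by (rule Least_Suc) (simp add: Inr)
      also have "\<dots> = Suc (D y)" by (simp only: D_def g_Suc_front Inr sum.case)
      finally have D: "D x = Suc (D y)" .
      have "isl (g T B k y)" using Suc.prems(2) unfolding g_Suc_front Inr by simp
      then have "{..D y} \<subseteq> D ` {1..length T}" using Suc.IH y by blast
      moreover have "Suc (D y) \<in> D ` {1..length T}"
        using D Suc.prems(1) by (intro image_eqI[of _ _ x]) simp_all
      ultimately show ?thesis using D by (simp add: atMost_Suc)
    qed
  qed
  then have "card {..D x} \<le> card (D ` {1..length T})" by (intro card_mono) auto
  also have "\<dots> \<le> length T" using card_image_le[of "{1..length T}" D] by simp
  finally have "D x \<le> length T" by simp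
  moreover have "isl (g T B (D x) x)" unfolding D_def using halt by (rule LeastI)
  ultimately show ?thesis by (rule isl_g_mono)
qed

lemma halts_step:
  assumes "g0 T B x = Inr y" "\<exists>k. isl (g T B k y)"
  shows "\<exists>k. isl (g T B k x)"
proof -
  obtain k where "isl (g T B k y)" using assms by blast
  then have "isl (g T B (Suc k) x)" using assms by (simp only: g_Suc_front sum.case)
  then show ?thesis by blast
qed

text \<open>The completions before and after appending agree on the prefix covered by
  \<open>P\<close>. A chain there either halts as before or leaves the prefix, and outside it all
  chains run rightwards until they meet a character.\<close>

lemma valid_PBP_snoc_right_reference:
  assumes P: "valid_PBP T P" and d: "0 < d" and l: "1 \<le> l"
    and lcp: "l \<le> lcp T (next_pos P) (next_pos P + d)"
  shows "valid_PBP T (P @ [Target (next_pos P + d) l])"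
proof -
  define t B B' where "t = next_pos P + d" and "B = completion T P"
    and "B' = completion T (P @ [Target t l])"
  have i: "1 \<le> next_pos P" by (simp add: next_pos_def)
  have bound: "next_pos P + d + l \<le> length T + 1"
    and eq: "\<forall>k<l. T ! (next_pos P - 1 + k) = T ! (next_pos P + d - 1 + k)"
    using le_lcp_iff[of "next_pos P" "next_pos P + d" l T] i l lcp by simp_all
  have "substr T t (t + l - 1) = substr T (next_pos P) (next_pos P + l - 1)"
    unfolding substr_eq_take_drop[OF l] t_def
    using eq bound i by (auto simp: list_eq_iff_nth_eq)
  then have PBP: "is_PBP T (P @ [Target t l])"
    using P l d bound
    by (auto simp: is_PBP_append_iff valid_PBP_def phrase_start_def next_pos_def t_def)
  then have BP': "is_BP T B'" unfolding B'_def by (rule is_BP_completion)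
  \<comment> \<open>Every position of the new phrase refers exactly \<open>d\<close> further right,
    so the distance to the end of \<open>T\<close> decreases.\<close>
  have right: "\<exists>k. isl (g T B' k x)" if "parse_len P < x" "x \<le> length T" for x
    using that
  proof (induction "length T - x" arbitrary: x rule: less_induct)
    case less
    show ?case
    proof (cases "x \<le> parse_len P + l")
      case True
      then have "g0 T B' x = Inr (t + (x - next_pos P))"
        using less.prems g0_snoc_Target[of P x l T t]
        unfolding B'_def completion_eq by (subst g0_append) simp_all
      moreover have "t + (x - next_pos P) = x + d"
        using less.prems by (simp add: t_def next_pos_def)
      moreover have "x + d \<le> length T" using True bound by (simp add: next_pos_def)
      ultimately show ?thesis using less.hyps[of "x + d"] less.prems d
        by (intro halts_step[of T B' x "x + d"]) auto
    next
      case False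
      then have "isl (g T B' 0 x)"
        using g0_completion_right[of "P @ [Target t l]" x T] less.prems by (simp add: B'_def)
      then show ?thesis by blast
    qed
  qed
  have BP: "is_BP T B" and halts: "\<forall>x\<in>{1..length T}. isl (g T B (length T) x)"
    using P by (simp_all add: valid_PBP_def valid_BP_def B_def)
  \<comment> \<open>The halting time in the old completion \<open>B\<close> serves only as induction
    measure. The time in \<open>B'\<close> may be longer; \<open>isl_g_length\<close> restores the
    bound \<open>length T\<close> afterwards.\<close>
  have all: "\<exists>k. isl (g T B' k x)" if "x \<in> {1..length T}" "isl (g T B k x)" for x k
    using that
  proof (induction k arbitrary: x)
    case 0
    show ?case
    proof (cases "x \<le> parse_len P")
      case True
      then have "isl (g T B' 0 x)" using 0 by (simp add: B_def B'_def completion_eq g0_append)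
      then show ?thesis by blast
    qed (use right 0 in simp)
  next
    case (Suc k)
    show ?case
    proof (cases "x \<le> parse_len P")
      case True
      then have same: "g0 T B' x = g0 T B x"
        using Suc.prems by (simp add: B_def B'_def completion_eq g0_append)
      show ?thesis
      proof (cases "g0 T B x")
        case (Inl c)
        then have "isl (g T B' 0 x)" using same by simp
        then show ?thesis by blast
      next
        case (Inr y)
        moreover have "y \<in> {1..length T}" using g0_Inr_in_range BP Suc.prems(1) Inr by blast
        moreover have "isl (g T B k y)" using Suc.prems(2) unfolding g_Suc_front Inr by simp
        ultimately show ?thesis using Suc.IH same by (intro halts_step[of T B' x y]) auto
      qed
    qed (use right Suc.prems in simp)
  qed
  have "valid_BP T B'"
    using BP' all halts isl_g_length[OF BP'] by (meson valid_BP_def)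
  then show ?thesis using PBP by (simp add: valid_PBP_def B'_def t_def)
qed

section \<open>Greedy phrases\<close>

lemma LF_ge:
  assumes "1 \<le> l" "l \<le> lcp T (next_pos P) j" "valid_PBP T (P @ [Target j l])"
  shows "l \<le> LF T P j"
  unfolding LF_def using assms by (intro Max_ge) auto

lemma LF_le_max_LF: "j \<in> {1..length T} \<Longrightarrow> LF T P j \<le> max_LF T P"
  unfolding max_LF_def by (intro Max_ge) auto

lemma valid_PBP_snoc_LF:
  assumes "0 < LF T P j"
  shows "valid_PBP T (P @ [Target j (LF T P j)])"
proof -
  have "LF T P j \<in> {0} \<union> {l \<in> {1..lcp T (next_pos P) j}. valid_PBP T (P @ [Target j l])}"
    unfolding LF_def by (intro Max_in) auto
  then show ?thesis using assms by simp
qed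

lemma valid_PBP_Nil: "valid_PBP T []"
proof -
  have PBP: "is_PBP T []" by (simp add: is_PBP_def)
  have "isl (g T (completion T []) (length T) x)" if "x \<in> {1..length T}" for x
    using isl_g_length[OF is_BP_completion[OF PBP] that, of 0]
      g0_completion_right[of "[]" x T] that by simp
  then show ?thesis
    using PBP is_BP_completion[OF PBP] by (simp add: valid_PBP_def valid_BP_def)
qed

text \<open>The completion already represents this position by the same character phrase, so it does
  not change.\<close>

lemma valid_PBP_snoc_Character:
  assumes "valid_PBP T P" "next_pos P \<le> length T"
  shows "valid_PBP T (P @ [Character (char_at T (next_pos P))])"
proof -
  have "drop (parse_len P) T = char_at T (next_pos P) # drop (Suc (parse_len P)) T"
    using assms(2) Cons_nth_drop_Suc[of "parse_len P" T] by (simp add: next_pos_def char_at_def)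
  then have "completion T (P @ [Character (char_at T (next_pos P))]) = completion T P"
    by (simp add: completion_eq)
  moreover have "is_PBP T (P @ [Character (char_at T (next_pos P))])"
    using assms by (simp add: is_PBP_append_iff valid_PBP_def phrase_start_def next_pos_def)
  ultimately show ?thesis using assms(1) by (simp add: valid_PBP_def)
qed

lemma LZRR_partial_imp_valid: "LZRR_partial T P \<Longrightarrow> valid_PBP T P"
proof (induction rule: LZRR_partial.induct)
  case (step P f)
  show ?case
  proof (cases "max_LF T P > 0")
    case True
    then obtain j where "LF T P j = max_LF T P" "f = Target j (max_LF T P)"
      using step.hyps(3) by (auto simp: is_LP_def)
    then show ?thesis using True valid_PBP_snoc_LF[of T P j] by simp
  next
    case False
    then show ?thesis using step valid_PBP_snoc_Character by (simp add: is_LP_def)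
  qed
qed (rule valid_PBP_Nil)

lemma LZRR_partial_snocD:
  assumes "LZRR_partial T (P @ [f])"
  shows "LZRR_partial T P" "next_pos P \<le> length T" "is_LP T P f"
  using assms by (auto elim: LZRR_partial.cases)

lemma is_LP_len_pos: "is_LP T P f \<Longrightarrow> 1 \<le> phrase_len f"
  by (auto simp: is_LP_def split: if_splits)

text \<open>The full common prefix with a position to the right is always a valid candidate, so the
  greedy maximum cannot be shorter.\<close>

lemma is_LP_len_ge_right_lcp:
  assumes "valid_PBP T P" "is_LP T P f" "0 < d"
  shows "lcp T (next_pos P) (next_pos P + d) \<le> phrase_len f"
proof (cases "lcp T (next_pos P) (next_pos P + d) = 0")
  case False
  define l where "l = lcp T (next_pos P) (next_pos P + d)"
  have l: "1 \<le> l" using False by (simp add: l_def)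
  have "next_pos P + d \<in> {1..length T}"
    using le_lcp_iff[of "next_pos P" "next_pos P + d" l T] l by (auto simp: next_pos_def l_def)
  moreover have "l \<le> LF T P (next_pos P + d)"
    using l assms by (intro LF_ge valid_PBP_snoc_right_reference) (simp_all add: l_def)
  ultimately have "l \<le> max_LF T P" using LF_le_max_LF order_trans by blast
  \<comment> \<open>As \<open>l\<close> is positive, so is \<open>max_LF T P\<close>; hence
    \<open>f\<close> is a target phrase of that length.\<close>
  then show ?thesis using assms(2) l by (auto simp: is_LP_def l_def split: if_splits)
qed simp

section \<open>Comparison with the LZ77 parse of the reversed string\<close>

lemma LZRR_phrase_reaches_end_of_LZ_phrase:
  assumes P: "LZRR_partial T (P @ [f])" and s: "1 \<le> s" "next_pos P + s \<le> length T + 1"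
    and inside: "length T + 1 < next_pos P + s + lz_len (rev T) s"
  shows "length T + 1 < next_pos (P @ [f]) + s"
proof -
  have np: "next_pos (P @ [f]) = next_pos P + phrase_len f" by (simp add: next_pos_def)
  have valid: "valid_PBP T P" and LP: "is_LP T P f"
    using LZRR_partial_snocD[OF P] LZRR_partial_imp_valid by blast+
  show ?thesis
    using s(1)
  proof (cases rule: lz_len_cases[where S = "rev T"])
    case 1
    then show ?thesis using inside is_LP_len_pos[OF LP] np by simp
  next
    case (2 p)
    then have "length T + 2 - s - next_pos P \<le> lcp T (next_pos P) (next_pos P + (s - p))"
      using s inside by (intro lcp_rev_imp_right_occurrence) simp_all
    also have "\<dots> \<le> phrase_len f" using 2 by (intro is_LP_len_ge_right_lcp[OF valid LP]) simp
    finally show ?thesis using np s by simp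
  qed
qed

text \<open>LZRR phrases are removed from the right while LZ77 phrases of \<open>rev T\<close> are
  consumed from the left. The invariant is that the last remaining LZRR phrase starts no later than
  the mirror image of \<open>s\<close>.\<close>

lemma length_LZRR_partial_le:
  assumes "LZRR_partial T (P @ [f])" "1 \<le> s" "next_pos P + s \<le> length T + 1"
  shows "length (P @ [f]) \<le> length (LZ_from (rev T) s)"
  using assms
proof (induction "length T + 1 - s" arbitrary: s P f rule: less_induct)
  case less
  define s' where "s' = s + lz_len (rev T) s"
  have s': "s < s'" by (simp add: s'_def lz_len_def)
  have s: "s \<le> length T" using less.prems(3) by (simp add: next_pos_def)
  then have len: "length (LZ_from (rev T) s) = Suc (length (LZ_from (rev T) s'))"
    by (subst LZ_from.simps) (simp add: s'_def)
  have IH: "length (Q @ [h]) \<le> length (LZ_from (rev T) s')"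
    if "LZRR_partial T (Q @ [h])" "next_pos Q + s' \<le> length T + 1" for Q h
    using less.hyps[of s' Q h] that s s' by simp
  show ?case
  \<comment> \<open>If \<open>f\<close> starts left of the mirrored LZ77 phrase, that phrase is
    consumed without removing \<open>f\<close>. Otherwise \<open>f\<close> starts inside it and is
    paired with it.\<close>
  proof (cases "next_pos P + s' \<le> length T + 1")
    case True
    then show ?thesis using IH less.prems(1) len by fastforce
  next
    case False
    show ?thesis
    proof (cases P rule: rev_cases)
      case Nil
      then show ?thesis using len by simp
    next
      case (snoc Q h)
      have Q: "LZRR_partial T (Q @ [h])" using LZRR_partial_snocD(1)[OF less.prems(1)] snoc by simp
      \<comment> \<open>If \<open>h\<close> also started inside the mirrored phrase, it would reach
        the end of that phrase, and \<open>f\<close> would start beyond it.\<close>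
      have "next_pos Q + s' \<le> length T + 1"
      proof (rule ccontr)
        assume "\<not> ?thesis"
        moreover have "next_pos Q + s \<le> length T + 1"
          using less.prems(3) snoc by (simp add: next_pos_def)
        ultimately have "length T + 1 < next_pos (Q @ [h]) + s"
          using LZRR_phrase_reaches_end_of_LZ_phrase[OF Q less.prems(2)] by (simp add: s'_def)
        then show False using less.prems(3) snoc by simp
      qed
      then show ?thesis using IH[OF Q] len snoc by simp
    qed
  qed
qed

theorem theorem2:
  fixes T :: "'a::linorder list" and F :: "'a phrase list"
  assumes "is_LZRR T F"
  shows "length F \<le> length (LZ (rev T))"
proof (cases F rule: rev_cases)
  case (snoc P f)
  then have P: "LZRR_partial T (P @ [f])" using assms by (simp add: is_LZRR_def)
  \<comment> \<open>The mirror image of position 1 is the last position of \<open>T\<close>, so for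
    \<open>s = 1\<close> the invariant only says that the last phrase starts within
    \<open>T\<close>.\<close>
  then show ?thesis
    using length_LZRR_partial_le[OF P, of 1] LZRR_partial_snocD(2)[OF P] snoc
    by (simp add: LZ_def)
qed simp

end
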